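(* Let $\Gamma$ be a $2\pi$-periodic coupling function such that (i) (monotonicity) $\Gamma$ is strictly monotone, i.e. either $\Gamma'(\theta)>0$ for all $\theta\in(0,2\pi)$, or $\Gamma'(\theta)<0$ for all $\theta\in(0,2\pi)$; and (ii) either $\Gamma''(\theta)\ge 0$ for all $\theta\in(0,2\pi)$, or $\Gamma''(\theta)\le 0$ for all $\theta\in(0,2\pi)$. Consider the $(N-1)$-dimensional dynamics $$\dot{\tilde\theta}_k=\Gamma(\tilde\theta_k)+\sum_{\substack{j=1\\ j\ne k}}^{N-1}\Gamma(\tilde\theta_k-\tilde\theta_j)-\sum_{j=1}^{N-1}\Gamma(-\tilde\theta_j),\qquad k=1,\dots,N-1,$$ and the open cone $$\mathcal{C}=\{\tilde\Theta=(\tilde\theta_1,\dots,\tilde\theta_{N-1})\in(0,2\pi)^{N-1} : \tilde\theta_k<\tilde\theta_{k+1},\ k=1,\dots,N-2\}.$$ Then these dynamics are either contracting (if $\Gamma'<0$) or expanding (if $\Gamma'>0$) in $\mathcal{C}$ with respect to the distance $$d(\mathbf{x},\mathbf{y})=\|\mathbf{x}-\mathbf{y}\|_{(1)}=|x_1-y_1|+\sum_{j=1}^{n-1}|x_{j+1}-y_{j+1}-(x_j-y_j)|+|x_n-y_n|,\qquad n=N-1.$$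
   Context: Contraction/expansion: let $\mathcal{S}$ be a continuous-time dynamical system defined on a metric space $X$ (with the distance $d$) and let $\mathbf{\Phi}$ denote the flow associated with $\mathcal{S}$, i.e. $\mathbf{\Phi}(\mathbf{x},t)$ is an orbit of $\mathcal{S}$ with $\mathbf{\Phi}(\mathbf{x},0)=\mathbf{x}\in X$. Then $\mathcal{S}$ is contracting (resp. expanding) in $X_0\subseteq X$ with respect to $d$ if $$\frac{d}{dt}\,d\big(\mathbf{\Phi}(\mathbf{x},t),\mathbf{\Phi}(\mathbf{y},t)\big)<0\quad(\text{resp. }>0)$$ for all $\mathbf{x}\ne\mathbf{y}$ and for all $t$ such that $\mathbf{\Phi}(\mathbf{x},t)\in X_0$ and $\mathbf{\Phi}(\mathbf{y},t)\in X_0$. The dynamics arise from a network of $N$ identical phase-coupled oscillators $\dot\theta_k=\omega+\sum_{j\ne k}\Gamma(\theta_k-\theta_j)$, $k=1,\dots,N$, with phases $\theta_k$ on the circle and natural frequency $\omega$, through the phase differences $\tilde\theta_k=\theta_{k+1}-\theta_1\in[0,2\pi]$, $k=1,\dots,N-1$. Without loss of generality the oscillators satisfy the phase ordering $\tilde\theta_k\le\tilde\theta_{k+1}$, which does not change over time since the oscillators are identical, so solutions evolve in the closure of $\mathcal{C}$. Since $\Gamma$ is $2\pi$-periodic, $\Gamma(0)=\Gamma(2\pi)$; being strictly monotone on $(0,2\pi)$, it is discontinuous at $0$, that is $\Gamma(0^-)\ne\Gamma(0^+)$.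
   Formalization: The distance d is built from absolute values, so its time derivative need not exist when a term vanishes; contracting (expanding) is taken to mean that both one-sided time derivatives exist and are negative (positive), which agrees with the derivative wherever it exists. *)

theory Defs
  imports "HOL-Analysis.Analysis"
begin

text \<open>
  A flow on \<open>X\<close> whose orbit through \<open>x\<close> is defined on the open time interval \<open>T x\<close>
  around \<open>0\<close>. Time domains are needed because orbits of the phase differences can
  reach the boundary of the cone in finite time. No continuity in \<open>x\<close> is required.
\<close>

definition local_flow :: "'a set \<Rightarrow> ('a \<Rightarrow> real set) \<Rightarrow> ('a \<Rightarrow> real \<Rightarrow> 'a) \<Rightarrow> bool" where
  "local_flow X T \<Phi> \<longleftrightarrow>
     (\<forall>x\<in>X. open (T x) \<and> is_interval (T x) \<and> 0 \<in> T x \<and> \<Phi> x 0 = x \<and>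
        (\<forall>s\<in>T x. \<Phi> x s \<in> X \<and> T (\<Phi> x s) = {t. s + t \<in> T x} \<and>
           (\<forall>t. s + t \<in> T x \<longrightarrow> \<Phi> (\<Phi> x s) t = \<Phi> x (s + t))))"

text \<open>
  The distance between two orbits need not be differentiable in \<open>t\<close> (for instance
  when it is built from absolute values), so a sign of its derivative means: both
  one-sided derivatives exist and have that sign. Where the derivative exists, they
  both coincide with it.
\<close>

definition derivative_neg :: "(real \<Rightarrow> real) \<Rightarrow> real \<Rightarrow> bool" where
  "derivative_neg f t \<longleftrightarrow>
     (\<exists>l r. (f has_real_derivative l) (at_left t) \<and> (f has_real_derivative r) (at_right t) \<and>
        l < 0 \<and> r < 0)"

definition derivative_pos :: "(real \<Rightarrow> real) \<Rightarrow> real \<Rightarrow> bool" where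
  "derivative_pos f t \<longleftrightarrow>
     (\<exists>l r. (f has_real_derivative l) (at_left t) \<and> (f has_real_derivative r) (at_right t) \<and>
        l > 0 \<and> r > 0)"

definition contracting_in ::
  "'a set \<Rightarrow> ('a \<Rightarrow> 'a \<Rightarrow> real) \<Rightarrow> ('a \<Rightarrow> real set) \<Rightarrow> ('a \<Rightarrow> real \<Rightarrow> 'a) \<Rightarrow> 'a set \<Rightarrow> bool" where
  "contracting_in X d T \<Phi> X0 \<longleftrightarrow>
     Metric_space X d \<and> X0 \<subseteq> X \<and>
     (\<forall>x\<in>X. \<forall>y\<in>X. x \<noteq> y \<longrightarrow>
        (\<forall>t \<in> T x \<inter> T y. \<Phi> x t \<in> X0 \<and> \<Phi> y t \<in> X0 \<longrightarrow>
           derivative_neg (\<lambda>s. d (\<Phi> x s) (\<Phi> y s)) t))"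

definition expanding_in ::
  "'a set \<Rightarrow> ('a \<Rightarrow> 'a \<Rightarrow> real) \<Rightarrow> ('a \<Rightarrow> real set) \<Rightarrow> ('a \<Rightarrow> real \<Rightarrow> 'a) \<Rightarrow> 'a set \<Rightarrow> bool" where
  "expanding_in X d T \<Phi> X0 \<longleftrightarrow>
     Metric_space X d \<and> X0 \<subseteq> X \<and>
     (\<forall>x\<in>X. \<forall>y\<in>X. x \<noteq> y \<longrightarrow>
        (\<forall>t \<in> T x \<inter> T y. \<Phi> x t \<in> X0 \<and> \<Phi> y t \<in> X0 \<longrightarrow>
           derivative_pos (\<lambda>s. d (\<Phi> x s) (\<Phi> y s)) t))"

text \<open>
  A vector of phase differences is a function on the index set \<open>{1..N - 1}\<close>,
  made total by the extensional function space \<open>\<rightarrow>\<^sub>E\<close>.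
\<close>

definition phase_cone :: "nat \<Rightarrow> (nat \<Rightarrow> real) set" where
  "phase_cone N =
     {\<theta> \<in> {1..N - 1} \<rightarrow>\<^sub>E {0<..<2 * pi}. \<forall>k\<in>{1..N - 2}. \<theta> k < \<theta> (k + 1)}"

definition phase_field :: "nat \<Rightarrow> (real \<Rightarrow> real) \<Rightarrow> (nat \<Rightarrow> real) \<Rightarrow> nat \<Rightarrow> real" where
  "phase_field N \<Gamma> \<theta> k =
     \<Gamma> (\<theta> k) + (\<Sum>j\<in>{1..N - 1} - {k}. \<Gamma> (\<theta> k - \<theta> j)) - (\<Sum>j=1..N - 1. \<Gamma> (- \<theta> j))"

text \<open>
  The state space \<open>X\<close> may contain part or all of the boundary of the cone. There the
  right-hand side involves \<open>\<Gamma> 0\<close>, at a jump of \<open>\<Gamma>\<close>, and nothing is assumed about how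
  an orbit moves, beyond the flow property. The closure is taken in the product
  topology of \<open>nat \<Rightarrow> real\<close>, which is the Euclidean one on the coordinates \<open>1, \<dots>, N - 1\<close>.
\<close>

definition phase_flow ::
  "nat \<Rightarrow> (real \<Rightarrow> real) \<Rightarrow> (nat \<Rightarrow> real) set \<Rightarrow> ((nat \<Rightarrow> real) \<Rightarrow> real set) \<Rightarrow>
     ((nat \<Rightarrow> real) \<Rightarrow> real \<Rightarrow> nat \<Rightarrow> real) \<Rightarrow> bool" where
  "phase_flow N \<Gamma> X T \<Phi> \<longleftrightarrow>
     phase_cone N \<subseteq> X \<and> X \<subseteq> closure (phase_cone N) \<and> local_flow X T \<Phi> \<and>
     (\<forall>x\<in>X. \<forall>t\<in>T x. \<Phi> x t \<in> phase_cone N \<longrightarrow>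
        (\<forall>k\<in>{1..N - 1}.
           ((\<lambda>s. \<Phi> x s k) has_real_derivative phase_field N \<Gamma> (\<Phi> x t) k) (at t)))"

definition dist1 :: "nat \<Rightarrow> (nat \<Rightarrow> real) \<Rightarrow> (nat \<Rightarrow> real) \<Rightarrow> real" where
  "dist1 n x y =
     \<bar>x 1 - y 1\<bar> + (\<Sum>j=1..n - 1. \<bar>x (j + 1) - y (j + 1) - (x j - y j)\<bar>) + \<bar>x n - y n\<bar>"

end

theory Submission
  imports Defs
begin

text \<open>
  Place the reference oscillator at phase \<open>0\<close> and repeat the configuration
  \<open>0 < \<theta>\<^sub>1 < \<dots> < \<theta>\<^sub>n < 2\<pi>\<close> periodically along the real line. The distance is then
  the sum, over the \<open>N\<close> gaps between cyclic neighbours, of the absolute difference of the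
  gaps in the two configurations (\<open>dist1_eq_sum_gaps\<close>): the two extra terms
  \<open>\<bar>x\<^sub>1 - y\<^sub>1\<bar>\<close> and \<open>\<bar>x\<^sub>n - y\<^sub>n\<bar>\<close> belong to the gaps next to the reference oscillator, so
  no oscillator is distinguished.

  A one-sided derivative of the distance is \<open>\<Sum>\<^sub>i \<sigma>\<^sub>i (W\<^sub>i\<^sub>+\<^sub>1 - W\<^sub>i)\<close>, where \<open>W\<^sub>i\<close> is the
  difference of the velocities of oscillator \<open>i\<close> in the two configurations and
  \<open>\<sigma>\<^sub>i \<in> [-1, 1]\<close> is the sign of the \<open>i\<close>-th gap difference, or some number in that
  interval if the gap difference vanishes. Each \<open>W\<^sub>i\<close> is a sum over \<open>j\<close> of the influence
  of oscillator \<open>j\<close>, and the sign is already right for each \<open>j\<close> separately. Start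
  counting at \<open>j\<close>, and let \<open>\<Delta>\<^sub>i\<close> be the difference between the two configurations in
  the phase of the \<open>i\<close>-th oscillator after \<open>j\<close>; it vanishes for \<open>i = 0\<close> and \<open>i = N\<close>. By
  the mean value theorem along the segment joining the configurations, the contribution
  of \<open>j\<close> is \<open>\<Sum>\<^sub>i \<sigma>\<^sub>i (a\<^sub>i\<^sub>+\<^sub>1 \<Delta>\<^sub>i\<^sub>+\<^sub>1 - a\<^sub>i \<Delta>\<^sub>i)\<close>, where the \<open>a\<^sub>i\<close> are values of \<open>\<Gamma>'\<close> at
  increasing arguments, hence monotone in \<open>i\<close> by the curvature hypothesis.

  If \<open>\<Gamma>' > 0\<close>, each term of such a sum is bounded below by the increment (or the
  decrement) of \<open>a\<^sub>i \<bar>\<Delta>\<^sub>i\<bar>\<close>, which telescopes to zero. Splitting off a constant weight,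
  the least \<open>a\<^sub>i\<close>, which contributes that constant times the distance, makes the
  inequality strict (\<open>weighted_sum_pos\<close>). The case \<open>\<Gamma>' < 0\<close> follows by passing to \<open>-\<Gamma>\<close>.
\<close>

section \<open>Sums weighted by signs\<close>

text \<open>
  A number \<open>s\<close> is a sign of \<open>e\<close> if it is a subgradient of the absolute value at \<open>e\<close>. At
  \<open>e = 0\<close> every number in \<open>[-1, 1]\<close> qualifies, because the one-sided derivatives of \<open>\<bar>f\<bar>\<close>
  at a zero of \<open>f\<close> use both signs.
\<close>

definition is_sign :: "real \<Rightarrow> real \<Rightarrow> bool" where
  "is_sign s e \<longleftrightarrow> \<bar>s\<bar> \<le> 1 \<and> s * e = \<bar>e\<bar>"

lemma is_sign_mult_le: "is_sign s e \<Longrightarrow> \<bar>s * x\<bar> \<le> \<bar>x\<bar>"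
  unfolding is_sign_def abs_mult by (metis abs_ge_zero mult_left_le_one_le)

text \<open>
  The term with index \<open>i\<close> equals \<open>a\<^sub>i \<bar>e\<^sub>i\<bar> - (a\<^sub>i - a\<^sub>i\<^sub>+\<^sub>1) \<sigma>\<^sub>i \<Delta>\<^sub>i\<^sub>+\<^sub>1\<close> with
  \<open>e\<^sub>i = \<Delta>\<^sub>i\<^sub>+\<^sub>1 - \<Delta>\<^sub>i\<close>. For decreasing \<open>a\<close> the triangle inequality
  \<open>\<bar>e\<^sub>i\<bar> \<ge> \<bar>\<Delta>\<^sub>i\<^sub>+\<^sub>1\<bar> - \<bar>\<Delta>\<^sub>i\<bar>\<close> bounds it below by \<open>a\<^sub>i\<^sub>+\<^sub>1 \<bar>\<Delta>\<^sub>i\<^sub>+\<^sub>1\<bar> - a\<^sub>i \<bar>\<Delta>\<^sub>i\<bar>\<close>.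
\<close>

lemma weighted_sum_nonneg_decreasing:
  fixes a \<Delta> \<sigma> :: "nat \<Rightarrow> real"
  assumes sign: "\<And>i. i < N \<Longrightarrow> is_sign (\<sigma> i) (\<Delta> (Suc i) - \<Delta> i)"
    and ends: "\<Delta> 0 = 0" "\<Delta> N = 0"
    and nonneg: "\<And>i. i \<le> N \<Longrightarrow> 0 \<le> a i"
    and decr: "\<And>i. i < N \<Longrightarrow> a (Suc i) \<le> a i"
  shows "0 \<le> (\<Sum>i<N. \<sigma> i * (a (Suc i) * \<Delta> (Suc i) - a i * \<Delta> i))"
proof -
  have "0 = (\<Sum>i<N. a (Suc i) * \<bar>\<Delta> (Suc i)\<bar> - a i * \<bar>\<Delta> i\<bar>)"
    using sum_lessThan_telescope[of "\<lambda>i. a i * \<bar>\<Delta> i\<bar>" N] ends by simp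
  also have "\<dots> \<le> (\<Sum>i<N. \<sigma> i * (a (Suc i) * \<Delta> (Suc i) - a i * \<Delta> i))"
  proof (rule sum_mono)
    fix i assume "i \<in> {..<N}"
    hence i: "i < N" by simp
    define e where "e = \<Delta> (Suc i) - \<Delta> i"
    have s: "\<sigma> i * e = \<bar>e\<bar>" "\<sigma> i * \<Delta> (Suc i) \<le> \<bar>\<Delta> (Suc i)\<bar>"
      using sign[OF i] is_sign_mult_le[OF sign[OF i], of "\<Delta> (Suc i)"]
      by (auto simp: e_def is_sign_def)
    have "a i * (\<bar>\<Delta> (Suc i)\<bar> - \<bar>\<Delta> i\<bar>) \<le> a i * \<bar>e\<bar>"
      using nonneg[of i] i by (intro mult_left_mono) (auto simp: e_def)
    moreover have "(a i - a (Suc i)) * (\<sigma> i * \<Delta> (Suc i)) \<le> (a i - a (Suc i)) * \<bar>\<Delta> (Suc i)\<bar>"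
      using decr[OF i] s(2) by (intro mult_left_mono) auto
    moreover have "\<sigma> i * (a (Suc i) * \<Delta> (Suc i) - a i * \<Delta> i) =
        a i * (\<sigma> i * e) - (a i - a (Suc i)) * (\<sigma> i * \<Delta> (Suc i))"
      by (simp add: e_def algebra_simps)
    ultimately show "a (Suc i) * \<bar>\<Delta> (Suc i)\<bar> - a i * \<bar>\<Delta> i\<bar> \<le>
        \<sigma> i * (a (Suc i) * \<Delta> (Suc i) - a i * \<Delta> i)"
      unfolding s(1) by (simp add: algebra_simps)
  qed
  finally show ?thesis .
qed

text \<open>
  The mirror image of the previous lemma, in which the roles of the two ends of each gap are
  exchanged: the term with index \<open>i\<close> is at least \<open>a\<^sub>i \<bar>\<Delta>\<^sub>i\<bar> - a\<^sub>i\<^sub>+\<^sub>1 \<bar>\<Delta>\<^sub>i\<^sub>+\<^sub>1\<bar>\<close>.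
\<close>

lemma weighted_sum_nonneg_increasing:
  fixes a \<Delta> \<sigma> :: "nat \<Rightarrow> real"
  assumes sign: "\<And>i. i < N \<Longrightarrow> is_sign (\<sigma> i) (\<Delta> (Suc i) - \<Delta> i)"
    and ends: "\<Delta> 0 = 0" "\<Delta> N = 0"
    and nonneg: "\<And>i. i \<le> N \<Longrightarrow> 0 \<le> a i"
    and incr: "\<And>i. i < N \<Longrightarrow> a i \<le> a (Suc i)"
  shows "0 \<le> (\<Sum>i<N. \<sigma> i * (a (Suc i) * \<Delta> (Suc i) - a i * \<Delta> i))"
proof -
  have "0 = (\<Sum>i<N. a i * \<bar>\<Delta> i\<bar> - a (Suc i) * \<bar>\<Delta> (Suc i)\<bar>)"
    using sum_lessThan_telescope'[of "\<lambda>i. a i * \<bar>\<Delta> i\<bar>" N] ends by simp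
  also have "\<dots> \<le> (\<Sum>i<N. \<sigma> i * (a (Suc i) * \<Delta> (Suc i) - a i * \<Delta> i))"
  proof (rule sum_mono)
    fix i assume "i \<in> {..<N}"
    hence i: "i < N" by simp
    define e where "e = \<Delta> (Suc i) - \<Delta> i"
    have s: "\<sigma> i * e = \<bar>e\<bar>" "- \<bar>\<Delta> i\<bar> \<le> \<sigma> i * \<Delta> i"
      using sign[OF i] is_sign_mult_le[OF sign[OF i], of "\<Delta> i"]
      by (auto simp: e_def is_sign_def)
    have "a (Suc i) * (\<bar>\<Delta> i\<bar> - \<bar>\<Delta> (Suc i)\<bar>) \<le> a (Suc i) * \<bar>e\<bar>"
      using nonneg[of "Suc i"] i by (intro mult_left_mono) (auto simp: e_def)
    moreover have "(a (Suc i) - a i) * (- \<bar>\<Delta> i\<bar>) \<le> (a (Suc i) - a i) * (\<sigma> i * \<Delta> i)"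
      using incr[OF i] s(2) by (intro mult_left_mono) auto
    moreover have "\<sigma> i * (a (Suc i) * \<Delta> (Suc i) - a i * \<Delta> i) =
        a (Suc i) * (\<sigma> i * e) + (a (Suc i) - a i) * (\<sigma> i * \<Delta> i)"
      by (simp add: e_def algebra_simps)
    ultimately show "a i * \<bar>\<Delta> i\<bar> - a (Suc i) * \<bar>\<Delta> (Suc i)\<bar> \<le>
        \<sigma> i * (a (Suc i) * \<Delta> (Suc i) - a i * \<Delta> i)"
      unfolding s(1) by (simp add: algebra_simps)
  qed
  finally show ?thesis .
qed

text \<open>
  The sum is linear in \<open>a\<close>, and for constant \<open>a\<close> it is the constant times \<open>\<Sum>\<^sub>i \<bar>e\<^sub>i\<bar>\<close>.
  Subtracting from \<open>a\<close> its least value therefore leaves a nonnegative sum and splits off a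
  positive one. The values \<open>a 0\<close> and \<open>a N\<close> are free because they are multiplied by zero.
\<close>

lemma weighted_sum_pos:
  fixes a \<Delta> \<sigma> :: "nat \<Rightarrow> real"
  assumes sign: "\<And>i. i < N \<Longrightarrow> is_sign (\<sigma> i) (\<Delta> (Suc i) - \<Delta> i)"
    and ends: "\<Delta> 0 = 0" "\<Delta> N = 0"
    and "N \<ge> 2"
    and pos: "\<And>i. 0 < i \<Longrightarrow> i < N \<Longrightarrow> 0 < a i"
    and mono: "(\<forall>i j. 0 < i \<longrightarrow> i \<le> j \<longrightarrow> j < N \<longrightarrow> a i \<le> a j) \<or>
               (\<forall>i j. 0 < i \<longrightarrow> i \<le> j \<longrightarrow> j < N \<longrightarrow> a j \<le> a i)"
    and nontrivial: "\<exists>i<N. \<Delta> (Suc i) \<noteq> \<Delta> i"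
  shows "0 < (\<Sum>i<N. \<sigma> i * (a (Suc i) * \<Delta> (Suc i) - a i * \<Delta> i))"
proof -
  \<comment> \<open>Extend \<open>a\<close> to the two end points without destroying monotonicity.\<close>
  define c where "c i = max 1 (min (N - 1) i)" for i
  define b where "b i = a (c i)" for i
  define m where "m = min (b 0) (b N)"
  have range: "0 < c i" "c i < N" for i
    using \<open>N \<ge> 2\<close> by (auto simp: c_def)
  have c_mono: "c i \<le> c j" if "i \<le> j" for i j
    using that by (auto simp: c_def)
  have m: "0 < m"
    using pos range by (simp add: m_def b_def)
  have b_mono: "(\<forall>i j. i \<le> j \<longrightarrow> b i \<le> b j) \<or> (\<forall>i j. i \<le> j \<longrightarrow> b j \<le> b i)"
    using mono range c_mono unfolding b_def by blast
  have m_le: "m \<le> b i" if "i \<le> N" for i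
    using b_mono
  proof
    assume "\<forall>i j. i \<le> j \<longrightarrow> b i \<le> b j"
    thus ?thesis by (simp add: m_def min.coboundedI1)
  next
    assume "\<forall>i j. i \<le> j \<longrightarrow> b j \<le> b i"
    thus ?thesis using that by (simp add: m_def min.coboundedI2)
  qed
  have rest: "0 \<le> (\<Sum>i<N. \<sigma> i * ((b (Suc i) - m) * \<Delta> (Suc i) - (b i - m) * \<Delta> i))"
    using b_mono
  proof
    assume "\<forall>i j. i \<le> j \<longrightarrow> b i \<le> b j"
    thus ?thesis
      using m_le by (intro weighted_sum_nonneg_increasing sign ends) auto
  next
    assume "\<forall>i j. i \<le> j \<longrightarrow> b j \<le> b i"
    thus ?thesis
      using m_le by (intro weighted_sum_nonneg_decreasing sign ends) auto
  qed
  have "0 < (\<Sum>i<N. \<bar>\<Delta> (Suc i) - \<Delta> i\<bar>)"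
    using nontrivial by (auto intro!: sum_pos2)
  hence main: "0 < m * (\<Sum>i<N. \<bar>\<Delta> (Suc i) - \<Delta> i\<bar>)"
    using m by simp
  have ba: "b i * \<Delta> i = a i * \<Delta> i" if "i \<le> N" for i
  proof (cases "i = 0 \<or> i = N")
    case False
    hence "c i = i" using that by (auto simp: c_def)
    thus ?thesis by (simp add: b_def)
  qed (use ends in auto)
  have "(\<Sum>i<N. \<sigma> i * (a (Suc i) * \<Delta> (Suc i) - a i * \<Delta> i)) =
      (\<Sum>i<N. \<sigma> i * ((b (Suc i) - m) * \<Delta> (Suc i) - (b i - m) * \<Delta> i) + m * \<bar>\<Delta> (Suc i) - \<Delta> i\<bar>)"
  proof (rule sum.cong)
    fix i assume "i \<in> {..<N}"
    hence i: "i < N" by simp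
    have abs_eq: "\<bar>\<Delta> (Suc i) - \<Delta> i\<bar> = \<sigma> i * (\<Delta> (Suc i) - \<Delta> i)"
      using sign[OF i] by (simp add: is_sign_def)
    have "\<sigma> i * (a (Suc i) * \<Delta> (Suc i) - a i * \<Delta> i) =
        \<sigma> i * (b (Suc i) * \<Delta> (Suc i) - b i * \<Delta> i)"
      using ba[of i] ba[of "Suc i"] i by (simp only: less_imp_le_nat Suc_le_eq)
    also have "\<dots> =
        \<sigma> i * ((b (Suc i) - m) * \<Delta> (Suc i) - (b i - m) * \<Delta> i) + m * \<bar>\<Delta> (Suc i) - \<Delta> i\<bar>"
      unfolding abs_eq by (simp add: algebra_simps)
    finally show "\<sigma> i * (a (Suc i) * \<Delta> (Suc i) - a i * \<Delta> i) =
        \<sigma> i * ((b (Suc i) - m) * \<Delta> (Suc i) - (b i - m) * \<Delta> i) + m * \<bar>\<Delta> (Suc i) - \<Delta> i\<bar>" .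
  qed simp
  also have "\<dots> = (\<Sum>i<N. \<sigma> i * ((b (Suc i) - m) * \<Delta> (Suc i) - (b i - m) * \<Delta> i)) +
      m * (\<Sum>i<N. \<bar>\<Delta> (Suc i) - \<Delta> i\<bar>)"
    by (simp add: sum.distrib sum_distrib_left)
  finally show ?thesis using rest main by linarith
qed

section \<open>The influence of one oscillator\<close>

text \<open>
  Here \<open>u\<close> and \<open>v\<close> list the phases relative to one oscillator, once around the circle. The
  function \<open>F\<close> below interpolates between the two configurations; its derivative has the
  form treated in \<open>weighted_sum_pos\<close>, since every intermediate configuration is again ordered.
\<close>

lemma influence_pos:
  fixes \<Gamma> \<Gamma>' :: "real \<Rightarrow> real" and u v \<sigma> :: "nat \<Rightarrow> real"
  assumes deriv: "\<And>\<theta>. \<theta> \<in> {0<..<L} \<Longrightarrow> (\<Gamma> has_real_derivative \<Gamma>' \<theta>) (at \<theta>)"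
    and pos: "\<And>\<theta>. \<theta> \<in> {0<..<L} \<Longrightarrow> 0 < \<Gamma>' \<theta>"
    and mono: "mono_on {0<..<L} \<Gamma>' \<or> antimono_on {0<..<L} \<Gamma>'"
    and u: "strict_mono u" "u 0 = 0" "u N = L"
    and v: "strict_mono v" "v 0 = 0" "v N = L"
    and sign: "\<And>i. i < N \<Longrightarrow> is_sign (\<sigma> i) ((u (Suc i) - u i) - (v (Suc i) - v i))"
    and "N \<ge> 2"
    and nontrivial: "\<exists>i<N. u (Suc i) - u i \<noteq> v (Suc i) - v i"
  shows "0 < (\<Sum>i<N. \<sigma> i * ((\<Gamma> (u (Suc i)) - \<Gamma> (v (Suc i))) - (\<Gamma> (u i) - \<Gamma> (v i))))"
proof -
  define \<Delta> where "\<Delta> i = u i - v i" for i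
  define z where "z i \<tau> = v i + \<tau> * \<Delta> i" for i \<tau>
  define F where "F \<tau> = (\<Sum>i<N. \<sigma> i * (\<Gamma> (z (Suc i) \<tau>) - \<Gamma> (z i \<tau>)))" for \<tau>
  define F' where
    "F' \<tau> = (\<Sum>i<N. \<sigma> i * (\<Gamma>' (z (Suc i) \<tau>) * \<Delta> (Suc i) - \<Gamma>' (z i \<tau>) * \<Delta> i))" for \<tau>
  have ends: "\<Delta> 0 = 0" "\<Delta> N = 0"
    using u v by (auto simp: \<Delta>_def)
  have z_less: "z i \<tau> < z j \<tau>" if "0 \<le> \<tau>" "\<tau> \<le> 1" "i < j" for i j \<tau>
  proof -
    have "u i < u j" "v i < v j"
      using u v that by (auto simp: strict_mono_def)
    hence "0 < (1 - \<tau>) * (v j - v i) + \<tau> * (u j - u i)"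
      using that(1,2) by (cases "\<tau> = 0") (auto intro!: add_nonneg_pos)
    thus ?thesis by (simp add: z_def \<Delta>_def algebra_simps)
  qed
  have z_in: "z i \<tau> \<in> {0<..<L}" if "0 \<le> \<tau>" "\<tau> \<le> 1" "0 < i" "i < N" for i \<tau>
    using z_less[of \<tau> 0 i] z_less[of \<tau> i N] that u v by (simp add: z_def \<Delta>_def)
  have dz: "((\<lambda>\<tau>. \<Gamma> (z i \<tau>)) has_real_derivative \<Gamma>' (z i \<tau>) * \<Delta> i) (at \<tau>)"
    if "0 \<le> \<tau>" "\<tau> \<le> 1" "i \<le> N" for i \<tau>
  proof (cases "i = 0 \<or> i = N")
    case True
    thus ?thesis using ends by (auto simp: z_def)
  next
    case False
    hence "(\<Gamma> has_real_derivative \<Gamma>' (z i \<tau>)) (at (z i \<tau>))"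
      using that by (intro deriv z_in) auto
    moreover have "((\<lambda>\<tau>. z i \<tau>) has_real_derivative \<Delta> i) (at \<tau>)"
      unfolding z_def by (auto intro!: derivative_eq_intros)
    ultimately show ?thesis by (rule DERIV_chain2)
  qed
  have dF: "(F has_real_derivative F' \<tau>) (at \<tau>)" if "0 \<le> \<tau>" "\<tau> \<le> 1" for \<tau>
    unfolding F_def F'_def using that
    by (intro DERIV_sum DERIV_cmult DERIV_diff dz) auto
  obtain \<tau> where \<tau>: "0 < \<tau>" "\<tau> < 1" "F 1 - F 0 = (1 - 0) * F' \<tau>"
    using MVT2[of 0 1 F F'] dF by auto
  have "0 < F' \<tau>"
    unfolding F'_def
  proof (rule weighted_sum_pos)
    show "is_sign (\<sigma> i) (\<Delta> (Suc i) - \<Delta> i)" if "i < N" for i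
      using sign[OF that] by (simp add: \<Delta>_def algebra_simps)
    show "\<exists>i<N. \<Delta> (Suc i) \<noteq> \<Delta> i"
      using nontrivial by (force simp: \<Delta>_def)
    show "0 < \<Gamma>' (z i \<tau>)" if "0 < i" "i < N" for i
      using that \<tau> by (intro pos z_in) auto
    have "z i \<tau> \<le> z j \<tau>" "z i \<tau> \<in> {0<..<L}" "z j \<tau> \<in> {0<..<L}"
      if "0 < i" "i \<le> j" "j < N" for i j
      using that \<tau> z_less[of \<tau> i j] z_in[of \<tau> i] z_in[of \<tau> j]
      by (cases "i = j"; force)+
    thus "(\<forall>i j. 0 < i \<longrightarrow> i \<le> j \<longrightarrow> j < N \<longrightarrow> \<Gamma>' (z i \<tau>) \<le> \<Gamma>' (z j \<tau>)) \<or>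
          (\<forall>i j. 0 < i \<longrightarrow> i \<le> j \<longrightarrow> j < N \<longrightarrow> \<Gamma>' (z j \<tau>) \<le> \<Gamma>' (z i \<tau>))"
      using mono unfolding monotone_on_def by meson
  qed (use ends \<open>N \<ge> 2\<close> in auto)
  moreover have "F 1 - F 0 =
      (\<Sum>i<N. \<sigma> i * ((\<Gamma> (u (Suc i)) - \<Gamma> (v (Suc i))) - (\<Gamma> (u i) - \<Gamma> (v i))))"
    unfolding F_def z_def \<Delta>_def sum_subtractf[symmetric]
    by (rule sum.cong) (auto simp: algebra_simps)
  ultimately show ?thesis using \<tau> by simp
qed

section \<open>Cyclic configurations\<close>

text \<open>
  The oscillators on the universal cover of the circle, numbered from the reference
  oscillator onwards: oscillator \<open>m mod N\<close> after \<open>m div N\<close> turns. The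
  reference oscillator has index and phase \<open>0\<close>.
\<close>

definition lift_phase :: "nat \<Rightarrow> (nat \<Rightarrow> real) \<Rightarrow> nat \<Rightarrow> real" where
  "lift_phase N x m = 2 * pi * real (m div N) + (if m mod N = 0 then 0 else x (m mod N))"

definition gap :: "nat \<Rightarrow> (nat \<Rightarrow> real) \<Rightarrow> nat \<Rightarrow> real" where
  "gap N x i = lift_phase N x (Suc i) - lift_phase N x i"

text \<open>
  Including the self-interaction \<open>\<Gamma> 0\<close> makes the formula uniform in \<open>i\<close>; it is the same for
  all oscillators and cancels from every difference.
\<close>

definition velocity :: "nat \<Rightarrow> (real \<Rightarrow> real) \<Rightarrow> (nat \<Rightarrow> real) \<Rightarrow> nat \<Rightarrow> real" where
  "velocity N \<Gamma> x i = (\<Sum>j<N. \<Gamma> (lift_phase N x i - lift_phase N x j))"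

lemma lift_phase_0 [simp]: "lift_phase N x 0 = 0"
  by (simp add: lift_phase_def)

lemma lift_phase_inner: "0 < i \<Longrightarrow> i < N \<Longrightarrow> lift_phase N x i = x i"
  by (simp add: lift_phase_def)

lemma lift_phase_add_period: "0 < N \<Longrightarrow> lift_phase N x (m + N) = lift_phase N x m + 2 * pi"
  by (simp add: lift_phase_def algebra_simps)

lemma lift_phase_period: "0 < N \<Longrightarrow> lift_phase N x N = 2 * pi"
  using lift_phase_add_period[of N x 0] by simp

lemma gap_add_period: "0 < N \<Longrightarrow> gap N x (i + N) = gap N x i"
  using lift_phase_add_period[of N x i] lift_phase_add_period[of N x "Suc i"]
  by (simp add: gap_def)

lemma periodic_mod:
  fixes f :: "nat \<Rightarrow> 'a"
  assumes "\<And>i. f (i + N) = f i"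
  shows "f (i mod N) = f i"
proof -
  have "f (k + N * q) = f k" for k q
  proof (induction q)
    case (Suc q)
    have "k + N * Suc q = (k + N * q) + N" by simp
    thus ?case using Suc assms by presburger
  qed simp
  from this[of "i mod N" "i div N"] show ?thesis by simp
qed

lemma sum_periodic_shift:
  fixes f :: "nat \<Rightarrow> 'a :: ab_group_add"
  assumes "\<And>i. f (i + N) = f i"
  shows "(\<Sum>i<N. f (j + i)) = (\<Sum>i<N. f i)"
proof (induction j)
  case (Suc j)
  have "f j + (\<Sum>i<N. f (Suc j + i)) = (\<Sum>i<Suc N. f (j + i))"
    by (subst sum.lessThan_Suc_shift) simp
  also have "\<dots> = (\<Sum>i<N. f (j + i)) + f j"
    using assms[of j] by simp
  finally show ?case using Suc by (simp add: add.commute)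
qed simp

lemma strict_mono_lift_phase:
  assumes "N \<ge> 2" "x \<in> phase_cone N"
  shows "strict_mono (lift_phase N x)"
  unfolding strict_mono_Suc_iff
proof
  fix m
  have range: "0 < x i" "x i < 2 * pi" if "0 < i" "i < N" for i
    using assms that by (force simp: phase_cone_def)+
  have step: "x i < x (Suc i)" if "0 < i" "Suc i < N" for i
    using assms that by (force simp: phase_cone_def)
  have "m mod N < N" using assms by simp
  consider "m mod N = N - 1" | "m mod N = 0" "N > 1" | "0 < m mod N" "Suc (m mod N) < N"
    using \<open>m mod N < N\<close> assms by linarith
  thus "lift_phase N x m < lift_phase N x (Suc m)"
  proof cases
    case 1
    hence "Suc (m mod N) = N" using assms by simp
    hence "Suc m mod N = 0" "Suc m div N = Suc (m div N)"
      by (simp_all add: mod_Suc div_Suc)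
    thus ?thesis
      using range[of "m mod N"] 1 assms by (simp add: lift_phase_def algebra_simps)
  next
    case 2
    hence "Suc m mod N = 1" "Suc m div N = m div N"
      using assms by (auto simp: mod_Suc div_Suc)
    thus ?thesis using range[of 1] assms 2 by (simp add: lift_phase_def)
  next
    case 3
    hence "Suc m mod N = Suc (m mod N)" "Suc m div N = m div N"
      by (auto simp: mod_Suc div_Suc)
    thus ?thesis using step[of "m mod N"] 3 by (simp add: lift_phase_def)
  qed
qed

lemma lift_phase_eq_sum_gaps: "lift_phase N x m = (\<Sum>i<m. gap N x i)"
  unfolding gap_def by (simp add: sum_lessThan_telescope)

lemma dist1_eq_sum_gaps:
  assumes "N \<ge> 2"
  shows "dist1 (N - 1) x y = (\<Sum>i<N. \<bar>gap N x i - gap N y i\<bar>)"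
proof -
  obtain n where n: "N = Suc (Suc n)"
    using assms by (metis Suc_le_D numeral_2_eq_2 Suc_le_mono)
  have "(\<Sum>i<N. \<bar>gap N x i - gap N y i\<bar>) =
      \<bar>gap N x 0 - gap N y 0\<bar> + (\<Sum>i<n. \<bar>gap N x (Suc i) - gap N y (Suc i)\<bar>) +
      \<bar>gap N x (Suc n) - gap N y (Suc n)\<bar>"
    unfolding n by (subst sum.lessThan_Suc_shift) simp
  also have "\<bar>gap N x 0 - gap N y 0\<bar> = \<bar>x 1 - y 1\<bar>"
    by (simp add: gap_def lift_phase_inner n)
  also have "\<bar>gap N x (Suc n) - gap N y (Suc n)\<bar> = \<bar>x (N - 1) - y (N - 1)\<bar>"
    using lift_phase_period[of N] by (simp add: gap_def lift_phase_inner n)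
  also have "(\<Sum>i<n. \<bar>gap N x (Suc i) - gap N y (Suc i)\<bar>) =
      (\<Sum>i<n. \<bar>x (Suc i + 1) - y (Suc i + 1) - (x (Suc i) - y (Suc i))\<bar>)"
    by (rule sum.cong) (auto simp: gap_def lift_phase_inner n algebra_simps)
  also have "\<dots> = (\<Sum>j=1..N - 1 - 1. \<bar>x (j + 1) - y (j + 1) - (x j - y j)\<bar>)"
    by (rule sum.reindex_bij_witness[of _ "\<lambda>j. j - 1" Suc]) (auto simp: n)
  finally show ?thesis by (simp add: dist1_def)
qed

lemma phase_field_eq_velocity:
  assumes "k \<in> {1..N - 1}"
  shows "phase_field N \<Gamma> x k = velocity N \<Gamma> x k - velocity N \<Gamma> x 0"
proof -
  have split: "{..<N} = insert 0 {1..N - 1}"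
    using assms by auto
  have k: "lift_phase N x k = x k"
    using assms by (intro lift_phase_inner) auto
  have "velocity N \<Gamma> x k = \<Gamma> (x k) + (\<Sum>j\<in>{1..N - 1}. \<Gamma> (x k - x j))"
    unfolding velocity_def split by (auto simp: k lift_phase_inner intro!: sum.cong)
  also have "(\<Sum>j\<in>{1..N - 1}. \<Gamma> (x k - x j)) = \<Gamma> 0 + (\<Sum>j\<in>{1..N - 1} - {k}. \<Gamma> (x k - x j))"
    using assms by (subst sum.remove[of _ k]) auto
  finally have "velocity N \<Gamma> x k =
      \<Gamma> (x k) + (\<Gamma> 0 + (\<Sum>j\<in>{1..N - 1} - {k}. \<Gamma> (x k - x j)))" .
  moreover have "velocity N \<Gamma> x 0 = \<Gamma> 0 + (\<Sum>j=1..N - 1. \<Gamma> (- x j))"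
    unfolding velocity_def split by (auto simp: lift_phase_inner intro!: sum.cong)
  ultimately show ?thesis by (simp add: phase_field_def)
qed

lemma gap_eqD:
  assumes "N \<ge> 2" "\<And>i. i < N \<Longrightarrow> gap N x i = gap N y i"
    and "x \<in> extensional {1..N - 1}" "y \<in> extensional {1..N - 1}"
  shows "x = y"
proof (rule extensionalityI[OF assms(3,4)])
  fix k assume k: "k \<in> {1..N - 1}"
  hence "lift_phase N x k = lift_phase N y k"
    unfolding lift_phase_eq_sum_gaps using assms(2) by (intro sum.cong) auto
  thus "x k = y k"
    using k lift_phase_inner[of k N x] lift_phase_inner[of k N y] by force
qed

lemma closure_phase_cone_subset: "closure (phase_cone N) \<subseteq> extensional {1..N - 1}"
proof (rule closure_minimal)
  show "phase_cone N \<subseteq> extensional {1..N - 1}"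
    by (auto simp: phase_cone_def PiE_def)
  have "extensional {1..N - 1} =
      (\<Inter>k\<in>- {1..N - 1}. {x :: nat \<Rightarrow> real. x k = undefined})"
    by (auto simp: extensional_def)
  also have "closed \<dots>"
    by (intro closed_INT ballI closed_Collect_eq continuous_on_product_coordinates
        continuous_on_const)
  finally show "closed (extensional {1..N - 1} :: (nat \<Rightarrow> real) set)" .
qed

lemma Metric_space_dist1:
  assumes "N \<ge> 2" "X \<subseteq> extensional {1..N - 1}"
  shows "Metric_space X (dist1 (N - 1))"
proof
  fix x y z
  show "0 \<le> dist1 (N - 1) x y"
    unfolding dist1_eq_sum_gaps[OF assms(1)] by (simp add: sum_nonneg)
  show "dist1 (N - 1) x y = dist1 (N - 1) y x"
    unfolding dist1_eq_sum_gaps[OF assms(1)] by (simp add: abs_minus_commute)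
  show "dist1 (N - 1) x y = 0 \<longleftrightarrow> x = y" if "x \<in> X" "y \<in> X"
    using gap_eqD[OF assms(1), of x y] that assms(2) unfolding dist1_eq_sum_gaps[OF assms(1)]
    by (auto simp: sum_nonneg_eq_0_iff)
  show "dist1 (N - 1) x z \<le> dist1 (N - 1) x y + dist1 (N - 1) y z"
    unfolding dist1_eq_sum_gaps[OF assms(1)] sum.distrib[symmetric]
    by (rule sum_mono) linarith
qed

section \<open>The sign of the one-sided derivatives of the distance\<close>

text \<open>
  The influences of the oscillators \<open>j\<close> are treated one at a time. For each \<open>j\<close> the sum over
  the gaps runs over one period of a periodic function, so it may start at \<open>j\<close>, which puts
  the self-interaction of \<open>j\<close>, where \<open>\<Gamma>\<close> jumps, at the two end points.
\<close>

lemma sum_signed_velocities_pos: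
  fixes \<Gamma> \<Gamma>' :: "real \<Rightarrow> real"
  assumes "N \<ge> 2"
    and periodic: "\<And>\<theta>. \<Gamma> (\<theta> + 2 * pi) = \<Gamma> \<theta>"
    and deriv: "\<And>\<theta>. \<theta> \<in> {0<..<2 * pi} \<Longrightarrow> (\<Gamma> has_real_derivative \<Gamma>' \<theta>) (at \<theta>)"
    and pos: "\<And>\<theta>. \<theta> \<in> {0<..<2 * pi} \<Longrightarrow> 0 < \<Gamma>' \<theta>"
    and mono: "mono_on {0<..<2 * pi} \<Gamma>' \<or> antimono_on {0<..<2 * pi} \<Gamma>'"
    and x: "x \<in> phase_cone N" and y: "y \<in> phase_cone N" and "x \<noteq> y"
    and sign: "\<And>i. i < N \<Longrightarrow> is_sign (\<sigma> i) (gap N x i - gap N y i)"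
  shows "0 < (\<Sum>i<N. \<sigma> i * ((velocity N \<Gamma> x (Suc i) - velocity N \<Gamma> x i) -
                            (velocity N \<Gamma> y (Suc i) - velocity N \<Gamma> y i)))"
proof -
  have N: "0 < N" using \<open>N \<ge> 2\<close> by simp
  define G where
    "G j k = \<Gamma> (lift_phase N x k - lift_phase N x j) - \<Gamma> (lift_phase N y k - lift_phase N y j)"
    for j k
  define f where "f j i = \<sigma> (i mod N) * (G j (Suc i) - G j i)" for j i
  have G_period: "G j (k + N) = G j k" for j k
    by (simp only: G_def lift_phase_add_period[OF N] diff_add_eq[symmetric] periodic)
  have f_period: "f j (i + N) = f j i" for i j
    using G_period[of j i] G_period[of j "Suc i"] by (simp add: f_def)
  have gap_mod: "gap N w (i mod N) = gap N w i" for w i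
    by (rule periodic_mod[of "gap N w"]) (rule gap_add_period[OF N])
  have influence: "0 < (\<Sum>i<N. f j i)" for j
  proof -
    define u where "u i = lift_phase N x (j + i) - lift_phase N x j" for i
    define v where "v i = lift_phase N y (j + i) - lift_phase N y j" for i
    have u_gap: "u (Suc i) - u i = gap N x (j + i)" for i
      by (simp add: u_def gap_def)
    have v_gap: "v (Suc i) - v i = gap N y (j + i)" for i
      by (simp add: v_def gap_def)
    have "0 < (\<Sum>i<N. \<sigma> ((j + i) mod N) *
        ((\<Gamma> (u (Suc i)) - \<Gamma> (v (Suc i))) - (\<Gamma> (u i) - \<Gamma> (v i))))"
    proof (rule influence_pos[OF deriv pos mono])
      show "strict_mono u" "strict_mono v"
        using strict_mono_lift_phase[OF \<open>N \<ge> 2\<close> x] strict_mono_lift_phase[OF \<open>N \<ge> 2\<close> y]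
        by (auto simp: u_def v_def strict_mono_def)
      show "u 0 = 0" "v 0 = 0" "u N = 2 * pi" "v N = 2 * pi"
        using lift_phase_add_period[OF N] by (auto simp: u_def v_def)
      show "is_sign (\<sigma> ((j + i) mod N)) ((u (Suc i) - u i) - (v (Suc i) - v i))" for i
        using sign[of "(j + i) mod N"] N by (simp add: u_gap v_gap gap_mod)
      show "\<exists>i<N. u (Suc i) - u i \<noteq> v (Suc i) - v i"
      proof (rule ccontr)
        assume "\<not> ?thesis"
        hence eq: "gap N x (j + i) = gap N y (j + i)" if "i < N" for i
          using that by (auto simp: u_gap v_gap)
        have "(\<Sum>i<N. \<bar>gap N x (j + i) - gap N y (j + i)\<bar>) = 0"
          by (simp add: eq)
        hence "(\<Sum>i<N. \<bar>gap N x i - gap N y i\<bar>) = 0"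
          by (subst (asm) sum_periodic_shift[of "\<lambda>i. \<bar>gap N x i - gap N y i\<bar>"])
            (simp_all add: gap_add_period[OF N])
        hence "\<And>i. i < N \<Longrightarrow> gap N x i = gap N y i"
          by (simp add: sum_nonneg_eq_0_iff)
        hence "x = y"
          using x y by (intro gap_eqD[OF \<open>N \<ge> 2\<close>]) (auto simp: phase_cone_def PiE_def)
        thus False using \<open>x \<noteq> y\<close> by simp
      qed
    qed (use \<open>N \<ge> 2\<close> in auto)
    also have "\<dots> = (\<Sum>i<N. f j (j + i))"
      by (simp add: f_def G_def u_def v_def)
    also have "\<dots> = (\<Sum>i<N. f j i)"
      by (rule sum_periodic_shift) (rule f_period)
    finally show ?thesis .
  qed
  have "0 < (\<Sum>j<N. \<Sum>i<N. f j i)"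
    by (rule sum_pos) (use N influence in auto)
  also have "\<dots> = (\<Sum>i<N. \<Sum>j<N. f j i)"
    by (rule sum.swap)
  also have "\<dots> = (\<Sum>i<N. \<sigma> i * ((velocity N \<Gamma> x (Suc i) - velocity N \<Gamma> x i) -
                            (velocity N \<Gamma> y (Suc i) - velocity N \<Gamma> y i)))"
  proof (rule sum.cong)
    fix i assume "i \<in> {..<N}"
    hence "(\<Sum>j<N. f j i) = \<sigma> i * (\<Sum>j<N. G j (Suc i) - G j i)"
      by (simp add: f_def sum_distrib_left)
    also have "(\<Sum>j<N. G j (Suc i) - G j i) =
        (velocity N \<Gamma> x (Suc i) - velocity N \<Gamma> x i) - (velocity N \<Gamma> y (Suc i) - velocity N \<Gamma> y i)"
      by (simp add: velocity_def G_def sum_subtractf)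
    finally show "(\<Sum>j<N. f j i) = \<sigma> i * ((velocity N \<Gamma> x (Suc i) - velocity N \<Gamma> x i) -
                            (velocity N \<Gamma> y (Suc i) - velocity N \<Gamma> y i))" .
  qed simp
  finally show ?thesis .
qed

lemma has_real_derivative_abs:
  fixes y :: real
  assumes "y \<noteq> 0"
  shows "(abs has_real_derivative sgn y) (at y)"
  using GDERIV_norm[OF assms]
  by (simp add: real_norm_def[abs_def])

text \<open>
  At a zero of \<open>f\<close> the one-sided derivatives of \<open>\<bar>f\<bar>\<close> are \<open>\<bar>D\<bar>\<close> and \<open>-\<bar>D\<bar>\<close>; elsewhere \<open>\<bar>f\<bar>\<close> is
  locally \<open>f\<close> or \<open>-f\<close>.
\<close>

lemma one_sided_derivatives_abs:
  fixes f :: "real \<Rightarrow> real"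
  assumes f: "(f has_real_derivative D) (at t)"
  shows "\<exists>s. is_sign s (f t) \<and> ((\<lambda>w. \<bar>f w\<bar>) has_real_derivative s * D) (at_left t)"
    and "\<exists>s. is_sign s (f t) \<and> ((\<lambda>w. \<bar>f w\<bar>) has_real_derivative s * D) (at_right t)"
proof -
  have "(\<exists>s. is_sign s (f t) \<and> ((\<lambda>w. \<bar>f w\<bar>) has_real_derivative s * D) (at_left t)) \<and>
        (\<exists>s. is_sign s (f t) \<and> ((\<lambda>w. \<bar>f w\<bar>) has_real_derivative s * D) (at_right t))"
  proof (cases "f t = 0")
    case True
    have lim: "((\<lambda>w. \<bar>(f w - f t) / (w - t)\<bar>) \<longlongrightarrow> \<bar>D\<bar>) (at t within S)" for S
      using f DERIV_subset[OF f, of S] unfolding has_field_derivative_iff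
      by (intro tendsto_rabs) auto
    have "((\<lambda>w. \<bar>f w\<bar>) has_real_derivative \<bar>D\<bar>) (at_right t)"
      unfolding has_field_derivative_iff
      by (rule Lim_transform_eventually[OF lim])
        (auto simp: eventually_at_filter abs_divide True)
    moreover have "((\<lambda>w. \<bar>f w\<bar>) has_real_derivative - \<bar>D\<bar>) (at_left t)"
      unfolding has_field_derivative_iff
      by (rule Lim_transform_eventually[OF tendsto_minus[OF lim]])
        (auto simp: eventually_at_filter abs_divide True field_simps)
    moreover have "\<bar>D\<bar> = sgn D * D" "- \<bar>D\<bar> = (- sgn D) * D"
      by (auto simp: abs_sgn mult.commute)
    moreover have "is_sign (sgn D) (f t)" "is_sign (- sgn D) (f t)"
      by (auto simp: is_sign_def True sgn_if)
    ultimately show ?thesis by metis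
  next
    case False
    have "((\<lambda>w. \<bar>f w\<bar>) has_real_derivative sgn (f t) * D) (at t)"
      using DERIV_chain2[OF has_real_derivative_abs[OF False] f] .
    moreover have "is_sign (sgn (f t)) (f t)"
      by (auto simp: is_sign_def sgn_if)
    ultimately show ?thesis
      using DERIV_subset[of "\<lambda>w. \<bar>f w\<bar>" _ t UNIV] by blast
  qed
  thus "\<exists>s. is_sign s (f t) \<and> ((\<lambda>w. \<bar>f w\<bar>) has_real_derivative s * D) (at_left t)"
    and "\<exists>s. is_sign s (f t) \<and> ((\<lambda>w. \<bar>f w\<bar>) has_real_derivative s * D) (at_right t)"
    by auto
qed

lemma local_flow_inj:
  assumes "local_flow X T \<Phi>" "x \<in> X" "y \<in> X" "t \<in> T x" "t \<in> T y" "\<Phi> x t = \<Phi> y t"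
  shows "x = y"
proof -
  have undo_flow: "\<Phi> (\<Phi> w t) (- t) = w" if "w \<in> X" "t \<in> T w" for w
  proof -
    have w0: "0 \<in> T w" "\<Phi> w 0 = w"
      and group: "\<And>s. t + s \<in> T w \<Longrightarrow> \<Phi> (\<Phi> w t) s = \<Phi> w (t + s)"
      using assms(1) that unfolding local_flow_def by blast+
    show ?thesis using group[of "- t"] w0 by simp
  qed
  have "x = \<Phi> (\<Phi> x t) (- t)"
    by (rule undo_flow[OF assms(2,4), symmetric])
  also have "\<dots> = y"
    unfolding assms(6) by (rule undo_flow[OF assms(3,5)])
  finally show ?thesis .
qed

lemma phase_flow_gap_derivative:
  assumes "N \<ge> 2"
    and periodic: "\<And>\<theta>. \<Gamma> (\<theta> + 2 * pi) = \<Gamma> \<theta>"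
    and flow: "phase_flow N \<Gamma> X T \<Phi>"
    and x: "x \<in> X" "t \<in> T x" "\<Phi> x t \<in> phase_cone N"
    and "i < N"
  shows "((\<lambda>s. gap N (\<Phi> x s) i) has_real_derivative
          velocity N \<Gamma> (\<Phi> x t) (Suc i) - velocity N \<Gamma> (\<Phi> x t) i) (at t)"
proof -
  let ?V = "velocity N \<Gamma> (\<Phi> x t)"
  have N: "0 < N" using \<open>N \<ge> 2\<close> by simp
  have VN: "?V N = ?V 0"
    unfolding velocity_def
  proof (rule sum.cong)
    fix j
    show "\<Gamma> (lift_phase N (\<Phi> x t) N - lift_phase N (\<Phi> x t) j) =
        \<Gamma> (lift_phase N (\<Phi> x t) 0 - lift_phase N (\<Phi> x t) j)"
      using periodic[of "- lift_phase N (\<Phi> x t) j"] lift_phase_period[OF N, of "\<Phi> x t"]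
      by (simp add: algebra_simps)
  qed simp
  \<comment> \<open>In the frame of the reference oscillator, whose lifts \<open>0\<close> and \<open>N\<close> do not move.\<close>
  have "((\<lambda>s. lift_phase N (\<Phi> x s) k) has_real_derivative ?V k - ?V 0) (at t)" if "k \<le> N" for k
  proof (cases "k = 0 \<or> k = N")
    case True
    thus ?thesis using VN lift_phase_period[OF N] by auto
  next
    case False
    hence k: "0 < k" "k < N" "k \<in> {1..N - 1}" using that by auto
    have "((\<lambda>s. \<Phi> x s k) has_real_derivative phase_field N \<Gamma> (\<Phi> x t) k) (at t)"
      using flow x k(3) unfolding phase_flow_def by blast
    thus ?thesis
      using k by (simp add: lift_phase_inner phase_field_eq_velocity)
  qed
  from DERIV_diff[OF this[of "Suc i"] this[of i]] \<open>i < N\<close> show ?thesis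
    by (simp add: gap_def)
qed

text \<open>
  The gap differences are differentiable along the flow, so each one-sided derivative of the
  distance is a sum with signs, and \<open>P\<close> only has to be known for such sums.
\<close>

lemma dist1_one_sided_derivatives:
  fixes P :: "real \<Rightarrow> bool"
  assumes "N \<ge> 2"
    and periodic: "\<And>\<theta>. \<Gamma> (\<theta> + 2 * pi) = \<Gamma> \<theta>"
    and flow: "phase_flow N \<Gamma> X T \<Phi>"
    and x: "x \<in> X" "t \<in> T x" "\<Phi> x t \<in> phase_cone N"
    and y: "y \<in> X" "t \<in> T y" "\<Phi> y t \<in> phase_cone N"
    and P: "\<And>\<sigma>. (\<And>i. i < N \<Longrightarrow> is_sign (\<sigma> i) (gap N (\<Phi> x t) i - gap N (\<Phi> y t) i)) \<Longrightarrow>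
        P (\<Sum>i<N. \<sigma> i * ((velocity N \<Gamma> (\<Phi> x t) (Suc i) - velocity N \<Gamma> (\<Phi> x t) i) -
                          (velocity N \<Gamma> (\<Phi> y t) (Suc i) - velocity N \<Gamma> (\<Phi> y t) i)))"
  shows "\<exists>l r. ((\<lambda>s. dist1 (N - 1) (\<Phi> x s) (\<Phi> y s)) has_real_derivative l) (at_left t) \<and>
               ((\<lambda>s. dist1 (N - 1) (\<Phi> x s) (\<Phi> y s)) has_real_derivative r) (at_right t) \<and>
               P l \<and> P r"
proof -
  define f where "f i s = gap N (\<Phi> x s) i - gap N (\<Phi> y s) i" for i s
  define D where "D i = (velocity N \<Gamma> (\<Phi> x t) (Suc i) - velocity N \<Gamma> (\<Phi> x t) i) -
                        (velocity N \<Gamma> (\<Phi> y t) (Suc i) - velocity N \<Gamma> (\<Phi> y t) i)" for i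
  have f: "(f i has_real_derivative D i) (at t)" if "i < N" for i
    unfolding f_def D_def using x y that
    by (intro DERIV_diff phase_flow_gap_derivative[OF \<open>N \<ge> 2\<close> periodic flow])
  obtain \<sigma> where \<sigma>: "\<And>i. i < N \<Longrightarrow> is_sign (\<sigma> i) (f i t)"
    "\<And>i. i < N \<Longrightarrow> ((\<lambda>w. \<bar>f i w\<bar>) has_real_derivative \<sigma> i * D i) (at_left t)"
    using one_sided_derivatives_abs(1)[OF f] by metis
  obtain \<rho> where \<rho>: "\<And>i. i < N \<Longrightarrow> is_sign (\<rho> i) (f i t)"
    "\<And>i. i < N \<Longrightarrow> ((\<lambda>w. \<bar>f i w\<bar>) has_real_derivative \<rho> i * D i) (at_right t)"
    using one_sided_derivatives_abs(2)[OF f] by metis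
  have "((\<lambda>s. \<Sum>i<N. \<bar>f i s\<bar>) has_real_derivative (\<Sum>i<N. \<sigma> i * D i)) (at_left t)"
    by (intro DERIV_sum \<sigma>(2)) simp
  moreover have "((\<lambda>s. \<Sum>i<N. \<bar>f i s\<bar>) has_real_derivative (\<Sum>i<N. \<rho> i * D i)) (at_right t)"
    by (intro DERIV_sum \<rho>(2)) simp
  moreover have "P (\<Sum>i<N. \<sigma> i * D i)" "P (\<Sum>i<N. \<rho> i * D i)"
    using P[of \<sigma>] P[of \<rho>] \<sigma>(1) \<rho>(1) by (simp_all add: f_def D_def)
  ultimately show ?thesis
    unfolding dist1_eq_sum_gaps[OF \<open>N \<ge> 2\<close>] f_def by blast
qed

lemma mono_or_antimono_from_derivative:
  fixes g g' :: "real \<Rightarrow> real"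
  assumes deriv: "\<And>\<theta>. \<theta> \<in> {a<..<b} \<Longrightarrow> (g has_real_derivative g' \<theta>) (at \<theta>)"
    and sign: "(\<forall>\<theta>\<in>{a<..<b}. g' \<theta> \<ge> 0) \<or> (\<forall>\<theta>\<in>{a<..<b}. g' \<theta> \<le> 0)"
  shows "mono_on {a<..<b} g \<or> antimono_on {a<..<b} g"
  using sign
proof
  assume nonneg: "\<forall>\<theta>\<in>{a<..<b}. g' \<theta> \<ge> 0"
  have "g r \<le> g s" if "r \<in> {a<..<b}" "s \<in> {a<..<b}" "r \<le> s" for r s
  proof (rule DERIV_nonneg_imp_nondecreasing[OF that(3)])
    fix w assume "r \<le> w" "w \<le> s"
    hence "w \<in> {a<..<b}" using that by simp
    thus "\<exists>D. (g has_real_derivative D) (at w) \<and> 0 \<le> D"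
      using deriv nonneg by blast
  qed
  thus ?thesis by (auto simp: monotone_on_def)
next
  assume nonpos: "\<forall>\<theta>\<in>{a<..<b}. g' \<theta> \<le> 0"
  have "g s \<le> g r" if "r \<in> {a<..<b}" "s \<in> {a<..<b}" "r \<le> s" for r s
  proof (rule DERIV_nonpos_imp_nonincreasing[OF that(3)])
    fix w assume "r \<le> w" "w \<le> s"
    hence "w \<in> {a<..<b}" using that by simp
    thus "\<exists>D. (g has_real_derivative D) (at w) \<and> D \<le> 0"
      using deriv nonpos by blast
  qed
  thus ?thesis by (auto simp: monotone_on_def)
qed

section \<open>Contraction and expansion\<close>

theorem theorem3p1:
  fixes N :: nat
    and \<Gamma> \<Gamma>' \<Gamma>'' :: "real \<Rightarrow> real"
    and X :: "(nat \<Rightarrow> real) set"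
    and T :: "(nat \<Rightarrow> real) \<Rightarrow> real set"
    and \<Phi> :: "(nat \<Rightarrow> real) \<Rightarrow> real \<Rightarrow> nat \<Rightarrow> real"
  assumes "N \<ge> 2"
    and periodic: "\<And>\<theta>. \<Gamma> (\<theta> + 2 * pi) = \<Gamma> \<theta>"
    and deriv1: "\<And>\<theta>. \<theta> \<in> {0<..<2 * pi} \<Longrightarrow> (\<Gamma> has_real_derivative \<Gamma>' \<theta>) (at \<theta>)"
    and deriv2: "\<And>\<theta>. \<theta> \<in> {0<..<2 * pi} \<Longrightarrow> (\<Gamma>' has_real_derivative \<Gamma>'' \<theta>) (at \<theta>)"
    and monotone: "(\<forall>\<theta>\<in>{0<..<2 * pi}. \<Gamma>' \<theta> > 0) \<or> (\<forall>\<theta>\<in>{0<..<2 * pi}. \<Gamma>' \<theta> < 0)"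
    and curvature: "(\<forall>\<theta>\<in>{0<..<2 * pi}. \<Gamma>'' \<theta> \<ge> 0) \<or> (\<forall>\<theta>\<in>{0<..<2 * pi}. \<Gamma>'' \<theta> \<le> 0)"
    and flow: "phase_flow N \<Gamma> X T \<Phi>"
  shows "((\<forall>\<theta>\<in>{0<..<2 * pi}. \<Gamma>' \<theta> < 0) \<longrightarrow>
            contracting_in X (dist1 (N - 1)) T \<Phi> (phase_cone N)) \<and>
         ((\<forall>\<theta>\<in>{0<..<2 * pi}. \<Gamma>' \<theta> > 0) \<longrightarrow>
            expanding_in X (dist1 (N - 1)) T \<Phi> (phase_cone N))"
proof -
  have X: "phase_cone N \<subseteq> X" "X \<subseteq> extensional {1..N - 1}" and lf: "local_flow X T \<Phi>"
    using flow closure_phase_cone_subset unfolding phase_flow_def by auto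
  have metric: "Metric_space X (dist1 (N - 1))"
    by (rule Metric_space_dist1[OF \<open>N \<ge> 2\<close> X(2)])
  have mono: "mono_on {0<..<2 * pi} \<Gamma>' \<or> antimono_on {0<..<2 * pi} \<Gamma>'"
    by (rule mono_or_antimono_from_derivative[OF deriv2 curvature])
  have distinct: "\<Phi> x t \<noteq> \<Phi> y t"
    if "x \<in> X" "y \<in> X" "x \<noteq> y" "t \<in> T x" "t \<in> T y" for x y t
    using local_flow_inj[OF lf] that by blast
  show ?thesis
  proof (intro conjI impI)
    assume neg: "\<forall>\<theta>\<in>{0<..<2 * pi}. \<Gamma>' \<theta> < 0"
    have mono': "mono_on {0<..<2 * pi} (\<lambda>\<theta>. - \<Gamma>' \<theta>) \<or> antimono_on {0<..<2 * pi} (\<lambda>\<theta>. - \<Gamma>' \<theta>)"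
      using mono by (auto simp: monotone_on_def)
    have velocity_minus: "velocity N (\<lambda>\<theta>. - \<Gamma> \<theta>) w i = - velocity N \<Gamma> w i" for w i
      by (simp add: velocity_def sum_negf)
    show "contracting_in X (dist1 (N - 1)) T \<Phi> (phase_cone N)"
      unfolding contracting_in_def derivative_neg_def
    proof (intro conjI metric X(1) ballI impI, elim IntE conjE)
      fix x y t
      assume *: "x \<in> X" "y \<in> X" "x \<noteq> y" "t \<in> T x" "t \<in> T y"
        "\<Phi> x t \<in> phase_cone N" "\<Phi> y t \<in> phase_cone N"
      show "\<exists>l r. ((\<lambda>s. dist1 (N - 1) (\<Phi> x s) (\<Phi> y s)) has_real_derivative l) (at_left t) \<and>
          ((\<lambda>s. dist1 (N - 1) (\<Phi> x s) (\<Phi> y s)) has_real_derivative r) (at_right t) \<and> l < 0 \<and> r < 0"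
      proof (rule dist1_one_sided_derivatives[OF \<open>N \<ge> 2\<close> periodic flow *(1,4,6,2,5,7)])
        fix \<sigma> :: "nat \<Rightarrow> real"
        assume sign: "\<And>i. i < N \<Longrightarrow> is_sign (\<sigma> i) (gap N (\<Phi> x t) i - gap N (\<Phi> y t) i)"
        have "0 < (\<Sum>i<N. \<sigma> i *
            ((velocity N (\<lambda>\<theta>. - \<Gamma> \<theta>) (\<Phi> x t) (Suc i) - velocity N (\<lambda>\<theta>. - \<Gamma> \<theta>) (\<Phi> x t) i) -
             (velocity N (\<lambda>\<theta>. - \<Gamma> \<theta>) (\<Phi> y t) (Suc i) - velocity N (\<lambda>\<theta>. - \<Gamma> \<theta>) (\<Phi> y t) i)))"
          using neg periodic deriv1
          by (intro sum_signed_velocities_pos[OF \<open>N \<ge> 2\<close> _ _ _ mono' *(6,7)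
                distinct[OF *(1-5)] sign])
            (auto intro: DERIV_minus)
        also have "\<dots> = - (\<Sum>i<N. \<sigma> i *
            ((velocity N \<Gamma> (\<Phi> x t) (Suc i) - velocity N \<Gamma> (\<Phi> x t) i) -
             (velocity N \<Gamma> (\<Phi> y t) (Suc i) - velocity N \<Gamma> (\<Phi> y t) i)))"
          unfolding velocity_minus sum_negf[symmetric]
          by (rule sum.cong) (auto simp: algebra_simps)
        finally show "(\<Sum>i<N. \<sigma> i *
            ((velocity N \<Gamma> (\<Phi> x t) (Suc i) - velocity N \<Gamma> (\<Phi> x t) i) -
             (velocity N \<Gamma> (\<Phi> y t) (Suc i) - velocity N \<Gamma> (\<Phi> y t) i))) < 0"
          by simp
      qed
    qed
  next
    assume pos: "\<forall>\<theta>\<in>{0<..<2 * pi}. \<Gamma>' \<theta> > 0"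
    show "expanding_in X (dist1 (N - 1)) T \<Phi> (phase_cone N)"
      unfolding expanding_in_def derivative_pos_def
    proof (intro conjI metric X(1) ballI impI, elim IntE conjE)
      fix x y t
      assume *: "x \<in> X" "y \<in> X" "x \<noteq> y" "t \<in> T x" "t \<in> T y"
        "\<Phi> x t \<in> phase_cone N" "\<Phi> y t \<in> phase_cone N"
      show "\<exists>l r. ((\<lambda>s. dist1 (N - 1) (\<Phi> x s) (\<Phi> y s)) has_real_derivative l) (at_left t) \<and>
          ((\<lambda>s. dist1 (N - 1) (\<Phi> x s) (\<Phi> y s)) has_real_derivative r) (at_right t) \<and> l > 0 \<and> r > 0"
        using pos
        by (intro dist1_one_sided_derivatives[OF \<open>N \<ge> 2\<close> periodic flow *(1,4,6,2,5,7)]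
            sum_signed_velocities_pos[OF \<open>N \<ge> 2\<close> periodic deriv1 _ mono *(6,7)
              distinct[OF *(1-5)]]) auto
    qed
  qed
qed

end
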